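(* Let $t\neq 0$. For every integer $n\ge 0$, $$\sum_{k=0}^n \frac{(-1)^k}{t^k} \left(L_{k+1} +(t-2)F_{k}\right) = \frac{(-1)^n}{t^n}F_{n+1},$$ where $F_k$ and $L_k$ are the $k$th Fibonacci and Lucas numbers.
   Context: The Fibonacci numbers $F_k$ and Lucas numbers $L_k$ ($k\ge 0$) both satisfy $x_{n+2}=x_{n+1}+x_n$ for $n\ge 0$, with initial values $F_0=0$, $F_1=1$ and $L_0=2$, $L_1=1$. Here $t$ is an indeterminate, which may be specialized to any nonzero complex number. *)

theory Defs
  imports "HOL-Number_Theory.Fib"
begin

fun lucas_num :: "nat \<Rightarrow> nat" where
  "lucas_num 0 = 2"
| "lucas_num (Suc 0) = 1"
| "lucas_num (Suc (Suc n)) = lucas_num (Suc n) + lucas_num n"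

end

(* Since L_{k+1} = F_{k+1} + 2 F_k, the k-th summand is (-1/t)^k (F_{k+1} + t F_k),
   which is (-1/t)^k F_{k+1} - (-1/t)^{k-1} F_k for k > 0, so the sum telescopes. *)
theory Submission
  imports Defs
begin

text \<open>Rewriting the Lucas number by \<open>lucas_num_Suc_eq_fib\<close> absorbs the -2, so
  each summand has a factor F_{k+1} + t F_k. In the induction the t F_{n+1} part of the new summand
  cancels the old sum, and the F_{n+2} part is the new value.\<close>

lemma lucas_num_Suc_eq_fib: "lucas_num (Suc n) = fib (Suc n) + 2 * fib n"
  by (induction n rule: fib.induct) simp_all

theorem mainTheorem3:
  fixes t :: "'a :: field" and n :: nat
  assumes "t \<noteq> 0"
  shows "(\<Sum>k=0..n. (-1) ^ k / t ^ k * (of_nat (lucas_num (k + 1)) + (t - 2) * of_nat (fib k)))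
         = (-1) ^ n / t ^ n * of_nat (fib (n + 1))"
proof -
  have summand: "of_nat (lucas_num (k + 1)) + (t - 2) * of_nat (fib k)
      = of_nat (fib (k + 1)) + t * of_nat (fib k)" for k
    by (simp add: lucas_num_Suc_eq_fib algebra_simps del: fib.simps lucas_num.simps)
  show ?thesis
    unfolding summand
  proof (induction n)
    case 0
    show ?case by simp
  next
    case (Suc n)
    \<comment> \<open>The factor \<open>t\<close> removes one power from the denominator and the
      extra -1 flips the sign, which gives minus the old partial sum.\<close>
    have "(-1) ^ Suc n / t ^ Suc n * (t * of_nat (fib (n + 1)))
        = - ((-1) ^ n / t ^ n * of_nat (fib (n + 1)))"
      using assms by (simp add: field_simps)
    with Suc show ?case
      \<comment> \<open>F_{n+2} and the powers stay folded, so that distributing exposes the product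
        evaluated above.\<close>
      by (simp add: distrib_left del: fib.simps power_Suc)
  qed
qed

end
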